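(* For all integers $r\ge 0$ and $s\ge 1$, $$\zeta^{\star}(r+2,\underbrace{2,\ldots,2}_{s-1}) = 2\sum_{m=0}^{\infty}\frac{(-1)^m}{(m+1)^{2s}}\left(\sum_{i=0}^{r}S_m(\underbrace{1,\ldots,1}_{r-i})\,S^{\star}_m(\underbrace{1,\ldots,1}_{i})\right).$$
   Context: For integers $k_1,\ldots,k_n\ge 1$ with $k_n\ge 2$, the multiple zeta-star value is $$\zeta^{\star}(k_1,\ldots,k_n) := \sum_{0<m_1\le\cdots\le m_n}\frac{1}{m_1^{k_1}\cdots m_n^{k_n}}.$$ For integers $k_1,\ldots,k_n\ge 1$ and $m\ge 0$, define the finite multiple harmonic sums $$S_m(k_1,\ldots,k_n) := \sum_{0\le m_1<\cdots<m_n<m}\frac{1}{(m_1+1)^{k_1}\cdots(m_n+1)^{k_n}},$$ $$S^{\star}_m(k_1,\ldots,k_n) := \sum_{0\le m_1\le\cdots\le m_n\le m}\frac{1}{(m_1+1)^{k_1}\cdots(m_n+1)^{k_n}}.$$ For the empty index (length $0$), both $S_m$ and $S^{\star}_m$ are defined to be $1$. An underbrace with number $j$ means that the entry is repeated $j$ times (so for $s=1$ the left-hand side is $\zeta^{\star}(r+2)$). *)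

theory Defs
  imports "HOL-Analysis.Analysis"
begin

text \<open>
  An index \<open>(k\<^sub>1, \<dots>, k\<^sub>n)\<close> is a list of natural numbers, and a summation tuple
  \<open>(m\<^sub>1, \<dots>, m\<^sub>n)\<close> is a list of the same length.
\<close>

definition mzsv_tuples :: "nat \<Rightarrow> nat list set" where
  "mzsv_tuples n = {ms. length ms = n \<and> (\<forall>m\<in>set ms. 0 < m) \<and> sorted ms}"

definition mzsv_term :: "nat list \<Rightarrow> nat list \<Rightarrow> real" where
  "mzsv_term ks ms = 1 / (\<Prod>i<length ks. real (ms ! i) ^ (ks ! i))"

text \<open>
  The last, that is largest, summation variable carries the last exponent. The terms are
  nonnegative, so the unordered sum is the usual one; \<open>infsum\<close> takes the value \<open>0\<close> if it diverges.
\<close>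

definition mzsv :: "nat list \<Rightarrow> real" where
  "mzsv ks = (\<Sum>\<^sub>\<infinity>ms\<in>mzsv_tuples (length ks). mzsv_term ks ms)"

definition mhs :: "nat \<Rightarrow> nat list \<Rightarrow> real" where
  "mhs m ks = (\<Sum>ms\<in>{ms. length ms = length ks \<and> sorted_wrt (<) ms \<and> (\<forall>x\<in>set ms. x < m)}.
     1 / (\<Prod>i<length ks. real (ms ! i + 1) ^ (ks ! i)))"

definition mhs_star :: "nat \<Rightarrow> nat list \<Rightarrow> real" where
  "mhs_star m ks = (\<Sum>ms\<in>{ms. length ms = length ks \<and> sorted ms \<and> (\<forall>x\<in>set ms. x \<le> m)}.
     1 / (\<Prod>i<length ks. real (ms ! i + 1) ^ (ks ! i)))"

text \<open>The index sets above are finite, and the empty index gives the value \<open>1\<close>.\<close>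

lemma finite_mhs_tuples:
  "finite {ms. length ms = n \<and> sorted_wrt (<) ms \<and> (\<forall>x\<in>set ms. x < (m::nat))}"
  by (rule finite_subset[OF _ finite_lists_length_eq[of "{..<m}" n]]) auto

lemma finite_mhs_star_tuples:
  "finite {ms. length ms = n \<and> sorted ms \<and> (\<forall>x\<in>set ms. x \<le> (m::nat))}"
  by (rule finite_subset[OF _ finite_lists_length_eq[of "{..m}" n]]) auto

lemma mhs_Nil: "mhs m [] = 1"
proof -
  have "{ms :: nat list. length ms = length ([] :: nat list) \<and> sorted_wrt (<) ms
    \<and> (\<forall>x\<in>set ms. x < m)} = {[]}" by auto
  then show ?thesis unfolding mhs_def by simp
qed

lemma mhs_star_Nil: "mhs_star m [] = 1"
proof -
  have "{ms :: nat list. length ms = length ([] :: nat list) \<and> sorted ms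
    \<and> (\<forall>x\<in>set ms. x \<le> m)} = {[]}" by auto
  then show ?thesis unfolding mhs_star_def by simp
qed

end

theory Submission
  imports Defs
begin

text \<open>
  Write \<open>P\<^sub>r(m)\<close> for the inner sum over \<open>i\<close>. The identity has an exact truncation: restricting the
  zeta-star sum to variables at most \<open>N\<close> inserts the factor
  \<open>\<Prod>j>N. (1 - n\<^sup>2 / j\<^sup>2) = (2N choose N-n) / (2N choose N)\<close>, with \<open>n = m + 1\<close>, into the
  \<open>m\<close>-th term on the right. It arises from the partial fractions of
  \<open>\<Prod>j=k..N. 1 / (1 - x\<^sup>2 / j\<^sup>2)\<close>, where \<open>k\<close> is the smallest summation variable and the
  coefficient of \<open>x\<^bsup>2(s-1)\<^esup>\<close> gives the remaining ones. Both sides of the truncated identity satisfy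
  the same recursion in \<open>N\<close> and \<open>s\<close>; the initial values, the case of exponent \<open>0\<close> on the
  right, follow by induction on \<open>r\<close> with summation by parts. The factor lies in \<open>[0, 1]\<close> and tends
  to \<open>1\<close>, and \<open>P\<^sub>r(m) = O(sqrt m)\<close>, so dominated convergence gives the theorem.
\<close>

section \<open>Recursions for the finite harmonic sums\<close>

lemma mhs_star_0: "mhs_star 0 ks = 1"
proof -
  have "{ms :: nat list. length ms = length ks \<and> sorted ms \<and> (\<forall>x\<in>set ms. x \<le> 0)}
      = {replicate (length ks) 0}"
    by (auto simp: replicate_eqI)
  then show ?thesis unfolding mhs_star_def by simp
qed

lemma prod_nth_snoc:
  assumes "length ms = length ks"
  shows "(\<Prod>i<length (ks @ [k]). real ((ms @ [m]) ! i + 1) ^ ((ks @ [k]) ! i))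
    = (\<Prod>i<length ks. real (ms ! i + 1) ^ (ks ! i)) * real (m + 1) ^ k"
  using assms by (auto simp: nth_append intro!: prod.cong)

text \<open>Split the tuples by whether the last entry is \<open>Suc m\<close>. If it is, the weak
  ordering lets the other entries reach \<open>Suc m\<close> too, so the shorter sum keeps the bound
  \<open>Suc m\<close>.\<close>

lemma mhs_star_Suc_snoc:
  "mhs_star (Suc m) (ks @ [k]) = mhs_star m (ks @ [k]) + mhs_star (Suc m) ks / real (m + 2) ^ k"
proof -
  define A where "A n M = {ms :: nat list. length ms = n \<and> sorted ms \<and> (\<forall>x\<in>set ms. x \<le> M)}" for n M
  define g where "g ks ms = 1 / (\<Prod>i<length ks. real (ms ! i + 1) ^ (ks ! i))" for ks ms :: "nat list"
  have fin: "finite (A n M)" for n M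
    unfolding A_def by (rule finite_mhs_star_tuples)
  have star: "mhs_star M l = sum (g l) (A (length l) M)" for M l
    by (simp add: mhs_star_def g_def A_def)
  have split: "A (Suc n) (Suc m) = A (Suc n) m \<union> (\<lambda>ms. ms @ [Suc m]) ` A n (Suc m)" for n
  proof (intro equalityI subsetI)
    fix ms assume ms: "ms \<in> A (Suc n) (Suc m)"
    then obtain l x where l: "ms = l @ [x]"
      by (cases ms rule: rev_cases) (auto simp: A_def)
    show "ms \<in> A (Suc n) m \<union> (\<lambda>ms. ms @ [Suc m]) ` A n (Suc m)"
      using ms unfolding l by (cases "x = Suc m") (force simp: A_def sorted_append)+
  qed (auto simp: A_def sorted_append)
  have disj: "A (Suc n) m \<inter> (\<lambda>ms. ms @ [Suc m]) ` A n (Suc m) = {}" for n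
    by (auto simp: A_def)
  have "mhs_star (Suc m) (ks @ [k]) = mhs_star m (ks @ [k])
      + (\<Sum>ms\<in>A (length ks) (Suc m). g (ks @ [k]) (ms @ [Suc m]))"
    unfolding star length_append_singleton split
    by (subst sum.union_disjoint) (auto simp: fin disj sum.reindex inj_on_def)
  also have "(\<Sum>ms\<in>A (length ks) (Suc m). g (ks @ [k]) (ms @ [Suc m]))
      = (\<Sum>ms\<in>A (length ks) (Suc m). g ks ms / real (m + 2) ^ k)"
  proof (rule sum.cong[OF refl])
    fix ms assume "ms \<in> A (length ks) (Suc m)"
    then have "length ms = length ks" by (simp add: A_def)
    from prod_nth_snoc[OF this, where k = k and m = "Suc m"] show "g (ks @ [k]) (ms @ [Suc m]) = g ks ms / real (m + 2) ^ k"
      unfolding g_def by (simp add: add.commute)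
  qed
  finally show ?thesis by (simp add: star sum_divide_distrib)
qed

lemma mhs_0_snoc: "mhs 0 (ks @ [k]) = 0"
proof -
  have "{ms :: nat list. length ms = length (ks @ [k]) \<and> sorted_wrt (<) ms \<and> (\<forall>x\<in>set ms. x < 0)} = {}"
    by (auto simp: length_Suc_conv)
  then show ?thesis unfolding mhs_def by (simp only: sum.empty)
qed

text \<open>The same split, but strictness keeps the entries before a last entry \<open>m\<close>
  below \<open>m\<close>, so the shorter sum stays at level \<open>m\<close>.\<close>

lemma mhs_Suc_snoc:
  "mhs (Suc m) (ks @ [k]) = mhs m (ks @ [k]) + mhs m ks / real (m + 1) ^ k"
proof -
  define A where "A n M = {ms :: nat list. length ms = n \<and> sorted_wrt (<) ms \<and> (\<forall>x\<in>set ms. x < M)}" for n M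
  define g where "g ks ms = 1 / (\<Prod>i<length ks. real (ms ! i + 1) ^ (ks ! i))" for ks ms :: "nat list"
  have fin: "finite (A n M)" for n M
    unfolding A_def by (rule finite_mhs_tuples)
  have mhs: "mhs M l = sum (g l) (A (length l) M)" for M l
    by (simp add: mhs_def g_def A_def)
  have split: "A (Suc n) (Suc m) = A (Suc n) m \<union> (\<lambda>ms. ms @ [m]) ` A n m" for n
  proof (intro equalityI subsetI)
    fix ms assume ms: "ms \<in> A (Suc n) (Suc m)"
    then obtain l x where l: "ms = l @ [x]"
      by (cases ms rule: rev_cases) (auto simp: A_def)
    show "ms \<in> A (Suc n) m \<union> (\<lambda>ms. ms @ [m]) ` A n m"
      using ms unfolding l by (cases "x = m") (force simp: A_def sorted_wrt_append less_Suc_eq)+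
  qed (auto simp: A_def sorted_wrt_append less_Suc_eq)
  have disj: "A (Suc n) m \<inter> (\<lambda>ms. ms @ [m]) ` A n m = {}" for n
    by (auto simp: A_def)
  have "mhs (Suc m) (ks @ [k]) = mhs m (ks @ [k])
      + (\<Sum>ms\<in>A (length ks) m. g (ks @ [k]) (ms @ [m]))"
    unfolding mhs length_append_singleton split
    by (subst sum.union_disjoint) (auto simp: fin disj sum.reindex inj_on_def)
  also have "(\<Sum>ms\<in>A (length ks) m. g (ks @ [k]) (ms @ [m]))
      = (\<Sum>ms\<in>A (length ks) m. g ks ms / real (m + 1) ^ k)"
  proof (rule sum.cong[OF refl])
    fix ms assume "ms \<in> A (length ks) m"
    then have "length ms = length ks" by (simp add: A_def)
    from prod_nth_snoc[OF this, where k = k and m = m] show "g (ks @ [k]) (ms @ [m]) = g ks ms / real (m + 1) ^ k"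
      unfolding g_def by simp
  qed
  finally show ?thesis by (simp add: mhs sum_divide_distrib)
qed

section \<open>Zeta-star values as limits of finite sums\<close>

text \<open>The tuples with bounded entries exhaust the index set. As the terms are nonnegative,
  bounded partial sums give unordered summability, and uniqueness of limits identifies the
  value.\<close>

lemma mzsv_term_has_sum:
  assumes lim: "(\<lambda>N. mhs_star N ks) \<longlonglongrightarrow> L"
  shows "(mzsv_term ks has_sum L) (mzsv_tuples (length ks))"
proof -
  define A where "A N = map Suc ` {ms :: nat list. length ms = length ks \<and> sorted ms \<and> (\<forall>x\<in>set ms. x \<le> N)}" for N
  have fin: "finite (A N)" for N
    unfolding A_def by (intro finite_imageI finite_mhs_star_tuples)
  have sum_A: "sum (mzsv_term ks) (A N) = mhs_star N ks" for N
    unfolding A_def mhs_star_def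
    by (subst sum.reindex) (auto intro!: sum.cong prod.cong simp: mzsv_term_def inj_on_def)
  have A_eq: "A N = {ms \<in> mzsv_tuples (length ks). \<forall>x\<in>set ms. x \<le> Suc N}" for N
  proof (intro equalityI subsetI)
    fix ms assume ms: "ms \<in> {ms \<in> mzsv_tuples (length ks). \<forall>x\<in>set ms. x \<le> Suc N}"
    \<comment> \<open>Entries are positive, so \<open>Suc\<close> undoes the truncated
      subtraction.\<close>
    then have eq: "ms = map Suc (map (\<lambda>x. x - 1) ms)"
      by (auto simp: mzsv_tuples_def o_def intro!: map_idI[symmetric])
    have "sorted (map (\<lambda>x. x - 1) ms)"
      using ms by (auto simp: mzsv_tuples_def sorted_map intro: sorted_wrt_mono_rel[of ms "(\<le>)"])
    then show "ms \<in> A N"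
      unfolding A_def using ms by (subst eq, intro imageI) (auto simp: mzsv_tuples_def)
  next
    fix ms assume "ms \<in> A N"
    then show "ms \<in> {ms \<in> mzsv_tuples (length ks). \<forall>x\<in>set ms. x \<le> Suc N}"
      by (auto simp: A_def mzsv_tuples_def sorted_map)
  qed
  have ex: "\<exists>N. F \<subseteq> A N" if "finite F" "F \<subseteq> mzsv_tuples (length ks)" for F
  proof -
    from that have "finite (\<Union>(set ` F))" by simp
    then obtain N where "\<forall>x\<in>\<Union>(set ` F). x \<le> N"
      using finite_nat_set_iff_bounded_le by blast
    then show ?thesis using that by (intro exI[of _ N]) (force simp: A_eq)
  qed
  have mono: "A M \<subseteq> A N" if "M \<le> N" for M N
    using that by (force simp: A_eq)
  have pos: "0 \<le> mzsv_term ks ms" for ms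
    by (auto simp: mzsv_term_def intro!: prod_nonneg)
  have "Bseq (\<lambda>N. mhs_star N ks)"
    using lim convergentI convergent_imp_Bseq by blast
  then obtain K where K: "\<And>N. norm (mhs_star N ks) \<le> K"
    unfolding Bseq_def by blast
  have "sum (mzsv_term ks) F \<le> K" if F: "finite F" "F \<subseteq> mzsv_tuples (length ks)" for F
  proof -
    obtain N where "F \<subseteq> A N" using ex[OF F] ..
    then have "sum (mzsv_term ks) F \<le> sum (mzsv_term ks) (A N)"
      by (intro sum_mono2 fin) (auto simp: pos)
    then show ?thesis using K[of N] by (simp add: sum_A)
  qed
  then have "mzsv_term ks summable_on mzsv_tuples (length ks)"
    by (intro nonneg_bdd_above_summable_on) (auto simp: pos bdd_above_def)
  then obtain S where S: "(mzsv_term ks has_sum S) (mzsv_tuples (length ks))"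
    by (auto simp: summable_on_def)
  have "filterlim A (finite_subsets_at_top (mzsv_tuples (length ks))) sequentially"
    unfolding filterlim_finite_subsets_at_top
  proof (intro allI impI)
    fix F assume "finite F \<and> F \<subseteq> mzsv_tuples (length ks)"
    then obtain N where "F \<subseteq> A N" using ex by blast
    then have "finite (A M) \<and> F \<subseteq> A M \<and> A M \<subseteq> mzsv_tuples (length ks)" if "N \<le> M" for M
      using mono[OF that] fin[of M] A_eq[of M] by blast
    then show "\<forall>\<^sub>F M in sequentially. finite (A M) \<and> F \<subseteq> A M \<and> A M \<subseteq> mzsv_tuples (length ks)"
      by (rule eventually_sequentiallyI)
  qed
  from filterlim_compose[OF S[unfolded has_sum_def] this]
  have "(\<lambda>N. mhs_star N ks) \<longlonglongrightarrow> S" by (simp add: sum_A)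
  then show ?thesis using S lim LIMSEQ_unique by blast
qed

section \<open>The inner sum: recursion and growth\<close>

definition inner_sum :: "nat \<Rightarrow> nat \<Rightarrow> real" where
  "inner_sum r m = (\<Sum>i=0..r. mhs m (replicate (r - i) 1) * mhs_star m (replicate i 1))"

lemma inner_sum_0_left: "inner_sum 0 m = 1"
  by (simp add: inner_sum_def mhs_Nil mhs_star_Nil)

lemma inner_sum_0_right: "inner_sum r 0 = 1"
proof -
  have "mhs 0 (replicate (Suc n) 1) = 0" for n
    unfolding replicate_Suc replicate_append_same[symmetric] by (rule mhs_0_snoc)
  then have "mhs 0 (replicate n 1) = (if n = 0 then 1 else 0)" for n
    by (cases n) (auto simp: mhs_Nil)
  then have "inner_sum r 0 = (\<Sum>i=0..r. if i = r then 1 else 0)"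
    unfolding inner_sum_def by (intro sum.cong) (auto simp: mhs_star_0)
  then show ?thesis by simp
qed

lemma inner_sum_Suc_Suc:
  "inner_sum (Suc r) (Suc m) = inner_sum (Suc r) m
    + inner_sum r (Suc m) / real (m + 2) + inner_sum r m / real (m + 1)"
proof -
  \<comment> \<open>Generating functions: \<open>E m = \<Prod>j=1..m. (1 + x/j)\<close> and \<open>H m = \<Prod>j=1..m+1. 1 / (1 - x/j)\<close>.\<close>
  define E where "E m = Abs_fps (\<lambda>n. mhs m (replicate n 1))" for m
  define H where "H m = Abs_fps (\<lambda>n. mhs_star m (replicate n 1))" for m
  have inner: "inner_sum r m = fps_nth (H m * E m) r" for r m
    unfolding inner_sum_def fps_mult_nth by (simp add: E_def H_def mult.commute)
  define a b where "a = fps_const (1 / real (m + 1))" and "b = fps_const (1 / real (m + 2))"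
  have E: "E (Suc m) = E m + a * fps_X * E m"
  proof (rule fps_ext)
    fix n show "fps_nth (E (Suc m)) n = fps_nth (E m + a * fps_X * E m) n"
      using mhs_Suc_snoc[of m "replicate (n - 1) 1" 1]
      by (cases n) (simp_all add: E_def a_def mhs_Nil mult.assoc replicate_append_same)
  qed
  have H: "H (Suc m) = H m + b * fps_X * H (Suc m)"
  proof (rule fps_ext)
    fix n show "fps_nth (H (Suc m)) n = fps_nth (H m + b * fps_X * H (Suc m)) n"
      using mhs_star_Suc_snoc[of m "replicate (n - 1) 1" 1]
      by (cases n) (simp_all add: H_def b_def mhs_star_Nil mult.assoc replicate_append_same)
  qed
  \<comment> \<open>In total, \<open>(1 - b X) H (Suc m) E (Suc m) = (1 + a X) H m E m\<close>; the
    claim is its coefficient at \<open>Suc r\<close>.\<close>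
  have "H (Suc m) * E (Suc m) = H m * E (Suc m) + b * (fps_X * (H (Suc m) * E (Suc m)))"
    by (subst H) (simp add: algebra_simps)
  also have "H m * E (Suc m) = H m * E m + a * (fps_X * (H m * E m))"
    by (subst E) (simp add: algebra_simps)
  finally have "fps_nth (H (Suc m) * E (Suc m)) (Suc r)
    = fps_nth (H m * E m + a * (fps_X * (H m * E m)) + b * (fps_X * (H (Suc m) * E (Suc m)))) (Suc r)"
    by simp
  then show ?thesis unfolding inner by (simp add: a_def b_def)
qed

lemma inner_sum_nonneg: "0 \<le> inner_sum r m"
proof (induction r arbitrary: m)
  case (Suc r)
  then show ?case by (induction m) (auto simp: inner_sum_0_right inner_sum_Suc_Suc)
qed (simp add: inner_sum_0_left)

text \<open>A crude bound that still makes the series with exponent 2 converge: by the recursion and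
  the bound for \<open>r\<close>, a step in \<open>m\<close> adds at most
  \<open>5 ^ r * (1 / b + 1 / a)\<close>, which increments of the square root absorb.\<close>

lemma inner_sum_le: "inner_sum r m \<le> 5 ^ r * sqrt (real (m + 1))"
proof (induction r arbitrary: m)
  case 0
  show ?case by (simp add: inner_sum_0_left)
next
  case (Suc r)
  show ?case
  proof (induction m)
    case 0
    show ?case using one_le_power[of "5::real" "Suc r"] by (simp add: inner_sum_0_right)
  next
    case IH: (Suc m)
    define a b where "a = sqrt (real (m + 1))" and "b = sqrt (real (m + 2))"
    have a2: "real (m + 1) = a\<^sup>2" and b2: "real (m + 2) = b\<^sup>2"
      by (simp_all add: a_def b_def)
    have a1: "1 \<le> a" and ab: "a \<le> b" by (simp_all add: a_def b_def)
    have b2': "b\<^sup>2 = a\<^sup>2 + 1" using a2 b2 by simp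
    \<comment> \<open>The constant 5 comes from
      \<open>(1 / b + 1 / a) * (b + a) = 2 + a / b + b / a\<close>, which is at most
      \<open>2 + 1 + 2\<close>.\<close>
    have *: "1 / b + 1 / a \<le> 5 * (b - a)"
    proof -
      have "(b - a) * (b + a) = 1" using b2' by (simp add: power2_eq_square algebra_simps)
      then have "b - a = 1 / (b + a)" using a1 ab by (simp add: field_simps)
      moreover have "(1 / b + 1 / a) * (b + a) \<le> 5"
      proof -
        have "b \<le> 2 * a"
          proof (rule power2_le_imp_le)
            show "b\<^sup>2 \<le> (2 * a)\<^sup>2"
              using one_le_power[OF a1, of 2] unfolding b2' by (simp add: power_mult_distrib)
          qed (use a1 in simp)
        then have "b / a \<le> 2" "a / b \<le> 1" using a1 ab by (auto simp: field_simps)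
        moreover have "(1 / b + 1 / a) * (b + a) = 2 + a / b + b / a"
          using a1 ab by (simp add: field_simps)
        ultimately show ?thesis by linarith
      qed
      ultimately show ?thesis
        using a1 ab pos_le_divide_eq[of "b + a" "1 / b + 1 / a" 5] by simp
    qed
    have "inner_sum r (Suc m) / real (m + 2) \<le> 5 ^ r * b / b\<^sup>2"
      using Suc.IH[of "Suc m"] unfolding b2 by (intro divide_right_mono) (auto simp: b_def add.commute)
    moreover have "inner_sum r m / real (m + 1) \<le> 5 ^ r * a / a\<^sup>2"
      using Suc.IH[of m] unfolding a2 by (intro divide_right_mono) (auto simp: a_def)
    moreover have "inner_sum (Suc r) m \<le> 5 ^ Suc r * a"
      using IH by (simp add: a_def)
    moreover have "5 ^ r * b / b\<^sup>2 + 5 ^ r * a / a\<^sup>2 = 5 ^ r * (1 / b + 1 / a)"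
      by (simp add: power2_eq_square algebra_simps)
    moreover have "5 ^ r * (1 / b + 1 / a) \<le> 5 ^ r * (5 * (b - a))"
      using * by (intro mult_left_mono) auto
    ultimately have "inner_sum (Suc r) (Suc m) \<le> 5 ^ Suc r * b"
      unfolding inner_sum_Suc_Suc by (simp add: algebra_simps)
    then show ?case by (simp add: b_def add.commute)
  qed
qed

section \<open>The truncation factor\<close>

text \<open>
  The ratio \<open>(2N choose N-n) / (2N choose N)\<close>; in product form it vanishes for \<open>n > N\<close> without a
  case distinction.
\<close>

definition binom_ratio :: "nat \<Rightarrow> nat \<Rightarrow> real" where
  "binom_ratio N n = (\<Prod>j<n. (real N - real j) / (real N + real j + 1))"

lemma binom_ratio_Suc_right: "binom_ratio N (Suc n) = binom_ratio N n * ((real N - real n) / (real N + real n + 1))"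
  by (simp add: binom_ratio_def)

lemma binom_ratio_eq_0: "N < n \<Longrightarrow> binom_ratio N n = 0"
  unfolding binom_ratio_def by (rule prod_zero) auto

lemma binom_ratio_bounds: "0 \<le> binom_ratio N n \<and> binom_ratio N n \<le> 1"
proof (cases "n \<le> N")
  case True
  then show ?thesis unfolding binom_ratio_def
    by (intro conjI prod_nonneg prod_le_1) (auto simp: field_simps)
qed (simp add: binom_ratio_eq_0)

lemma binom_ratio_tendsto: "(\<lambda>N. binom_ratio N n) \<longlonglongrightarrow> 1"
proof -
  have "(\<lambda>N. (real N - real j) / (real N + real j + 1)) \<longlonglongrightarrow> 1" for j
  proof -
    have "(\<lambda>N. 1 - (2 * real j + 1) * inverse (real (N + j + 1))) \<longlonglongrightarrow> 1 - (2 * real j + 1) * 0"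
      using LIMSEQ_ignore_initial_segment[OF LIMSEQ_inverse_real_of_nat, of j]
      by (intro tendsto_intros) simp
    moreover have "1 - (2 * real j + 1) * inverse (real (N + j + 1))
        = (real N - real j) / (real N + real j + 1)" for N
      by (simp add: field_simps)
    ultimately show ?thesis by simp
  qed
  then have "(\<lambda>N. binom_ratio N n) \<longlonglongrightarrow> (\<Prod>j<n. 1)"
    unfolding binom_ratio_def by (intro tendsto_prod)
  then show ?thesis by simp
qed

text \<open>Raising \<open>N\<close> removes the factor \<open>1 - n^2 / (N + 1)^2\<close> from the
  tail product. The form without division also covers \<open>n = N + 1\<close>, where both sides
  vanish.\<close>

lemma binom_ratio_Suc_left:
  "binom_ratio (Suc N) n * ((real N + 1)\<^sup>2 - (real n)\<^sup>2) = binom_ratio N n * (real N + 1)\<^sup>2"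
proof (induction n)
  case 0
  show ?case by (simp add: binom_ratio_def)
next
  case (Suc n)
  have "binom_ratio (Suc N) (Suc n) * ((real N + 1)\<^sup>2 - (real (Suc n))\<^sup>2)
      = binom_ratio (Suc N) n * (real N + 1 - real n) * (real N - real n)"
    unfolding binom_ratio_Suc_right by (simp add: field_simps power2_eq_square)
  also have "\<dots> = binom_ratio (Suc N) n * ((real N + 1)\<^sup>2 - (real n)\<^sup>2) * ((real N - real n) / (real N + real n + 1))"
    by (simp add: field_simps power2_eq_square)
  finally show ?case unfolding Suc.IH binom_ratio_Suc_right by simp
qed

section \<open>The exact truncated identity\<close>

definition truncated_rhs :: "nat \<Rightarrow> nat \<Rightarrow> nat \<Rightarrow> real" where
  "truncated_rhs r N s = (\<Sum>m\<le>N. 2 * (-1) ^ m * binom_ratio (Suc N) (Suc m) * inner_sum r m / real (m + 1) ^ (2 * s))"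

lemma truncated_rhs_0: "truncated_rhs r 0 s = 1"
  by (simp add: truncated_rhs_def inner_sum_0_right binom_ratio_def)

text \<open>This is the recursion of \<open>mhs_star_Suc_snoc\<close> with last exponent 2; it comes
  termwise from \<open>binom_ratio_Suc_left\<close>.\<close>

lemma truncated_rhs_Suc:
  "truncated_rhs r (Suc N) (Suc s) = truncated_rhs r N (Suc s) + truncated_rhs r (Suc N) s / real (N + 2) ^ 2"
proof -
  define t where "t m = 2 * (-1) ^ m * inner_sum r m / real (m + 1) ^ (2 * s)" for m
  have step: "binom_ratio (Suc (Suc N)) (Suc m) / real (m + 1) ^ 2
      = binom_ratio (Suc N) (Suc m) / real (m + 1) ^ 2 + binom_ratio (Suc (Suc N)) (Suc m) / real (N + 2) ^ 2" for m
    using binom_ratio_Suc_left[of "Suc N" "Suc m"] by (simp add: field_simps)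
  have "truncated_rhs r (Suc N) (Suc s) = (\<Sum>m\<le>Suc N. t m * (binom_ratio (Suc (Suc N)) (Suc m) / real (m + 1) ^ 2))"
    unfolding truncated_rhs_def t_def by (intro sum.cong) (simp_all add: power2_eq_square mult_ac)
  also have "\<dots> = (\<Sum>m\<le>Suc N. t m * (binom_ratio (Suc N) (Suc m) / real (m + 1) ^ 2))
      + (\<Sum>m\<le>Suc N. t m * binom_ratio (Suc (Suc N)) (Suc m)) / real (N + 2) ^ 2"
    unfolding step by (simp add: distrib_left sum.distrib sum_divide_distrib del: sum.atMost_Suc)
  \<comment> \<open>The extra term \<open>m = Suc N\<close> vanishes because
    \<open>binom_ratio (Suc N) (Suc (Suc N)) = 0\<close>.\<close>
  also have "(\<Sum>m\<le>Suc N. t m * (binom_ratio (Suc N) (Suc m) / real (m + 1) ^ 2)) = truncated_rhs r N (Suc s)"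
    unfolding truncated_rhs_def t_def by (simp add: binom_ratio_eq_0 power2_eq_square mult_ac)
  also have "(\<Sum>m\<le>Suc N. t m * binom_ratio (Suc (Suc N)) (Suc m)) = truncated_rhs r (Suc N) s"
    unfolding truncated_rhs_def t_def by (intro sum.cong) simp_all
  finally show ?thesis .
qed

lemma truncated_rhs_exponent_0: "truncated_rhs r N 0 = 1 / real (N + 1) ^ r"
proof (induction r)
  \<comment> \<open>\<open>D m\<close> is the tail from \<open>m\<close> of the alternating sum of the weights \<open>2 (-1)\<^sup>m binom_ratio (N+1) (m+1)\<close>.\<close>
  define D where "D m = (-1) ^ m * binom_ratio (Suc N) (Suc m) * (real N + real m + 2) / (real N + 1)" for m
  have D0: "D 0 = 1" by (simp add: D_def binom_ratio_def) (simp add: algebra_simps)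
  have DN: "D (Suc N) = 0" by (simp add: D_def binom_ratio_eq_0)
  have DS: "D (Suc m) = - ((-1) ^ m * binom_ratio (Suc N) (Suc m) * (real N - real m) / (real N + 1))" for m
  proof -
    have "binom_ratio (Suc N) (Suc (Suc m)) * (real N + real (Suc m) + 2) = binom_ratio (Suc N) (Suc m) * (real N - real m)"
      unfolding binom_ratio_Suc_right[of _ "Suc m"] by (simp add: add_ac)
    then show ?thesis unfolding D_def by (simp add: mult.assoc)
  qed
  have Dm: "D m - D (Suc m) = 2 * (-1) ^ m * binom_ratio (Suc N) (Suc m)" for m
    unfolding DS unfolding D_def diff_minus_eq_add add_divide_distrib[symmetric]
    by (simp add: field_simps)
  \<comment> \<open>The factor \<open>m + 1\<close> cancels the denominator of \<open>G\<close>
    below, leaving the \<open>1 / (N + 1)\<close> that raises the power in the induction on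
    \<open>r\<close>.\<close>
  have Dp: "D m + D (Suc m) = 2 * (-1) ^ m * binom_ratio (Suc N) (Suc m) * real (m + 1) / real (N + 1)" for m
    unfolding DS unfolding D_def add_uminus_conv_diff diff_divide_distrib[symmetric]
    by (simp add: field_simps)
  {
    case 0
    have "truncated_rhs 0 N 0 = (\<Sum>m<Suc N. D m - D (Suc m))"
      by (simp add: truncated_rhs_def inner_sum_0_left Dm lessThan_Suc_atMost del: sum.atMost_Suc sum.lessThan_Suc)
    also have "\<dots> = 1" unfolding sum_lessThan_telescope' D0 DN by simp
    finally show ?case by simp
  next
    case (Suc r)
    define F where "F m = inner_sum (Suc r) m" for m
    define G where "G m = inner_sum r m / real (m + 1)" for m
    have FG: "F m + G m = F (Suc m) - G (Suc m)" for m
      unfolding F_def G_def inner_sum_Suc_Suc by (simp add: add.commute)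
    have "truncated_rhs (Suc r) N 0 - truncated_rhs r N 0 / real (N + 1)
        = (\<Sum>m<Suc N. (D m - D (Suc m)) * F m - (D m + D (Suc m)) * G m)"
      unfolding truncated_rhs_def sum_divide_distrib sum_subtractf[symmetric] lessThan_Suc_atMost Dm Dp
      by (intro sum.cong) (simp_all add: F_def G_def)
    \<comment> \<open>Regrouping gives \<open>D m * (F m - G m) - D (Suc m) * (F m + G m)\<close>;
      by \<open>FG\<close> it telescopes. The ends vanish because \<open>F 0 = G 0\<close> and
      \<open>D (Suc N) = 0\<close>.\<close>
    also have "\<dots> = (\<Sum>m<Suc N. D m * (F m - G m) - D (Suc m) * (F (Suc m) - G (Suc m)))"
      unfolding FG[symmetric] by (simp add: algebra_simps)
    also have "\<dots> = 0"
      by (subst sum_lessThan_telescope') (simp add: DN F_def G_def inner_sum_0_right)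
    finally show ?case using Suc by (simp add: field_simps)
  }
qed

text \<open>The variables of \<open>mhs_star N\<close> are shifted by one, which is why the
  truncation level inside \<open>truncated_rhs\<close> is \<open>Suc N\<close>.\<close>

lemma mhs_star_eq_fin_sum:
  "mhs_star N ((r + 2) # replicate s 2) = truncated_rhs r N (Suc s)"
proof (induction s arbitrary: N)
  case 0
  show ?case
  proof (induction N)
    case (Suc N)
    \<comment> \<open>The new term is \<open>truncated_rhs r (Suc N) 0\<close> divided by
      \<open>(N + 2)^2\<close>, so the exponent-0 evaluation closes this case.\<close>
    have "mhs_star (Suc N) [r + 2] = mhs_star N [r + 2] + 1 / real (N + 2) ^ (r + 2)"
      using mhs_star_Suc_snoc[of N "[]" "r + 2"] by (simp add: mhs_star_Nil)
    then show ?case using Suc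
      by (simp add: truncated_rhs_Suc truncated_rhs_exponent_0 add.commute power_add power2_eq_square)
  qed (simp add: mhs_star_0 truncated_rhs_0)
next
  case IH: (Suc s)
  show ?case
  proof (induction N)
    case (Suc N)
    then show ?case
      using mhs_star_Suc_snoc[of N "(r + 2) # replicate s 2" 2] IH
      by (simp add: truncated_rhs_Suc[of r N "Suc s"] replicate_append_same)
  qed (simp add: mhs_star_0 truncated_rhs_0)
qed

section \<open>Domination and passage to the limit\<close>

lemma summable_inner_sum_bound: "summable (\<lambda>m. inner_sum r m / real (m + 1) ^ 2)"
proof (rule summable_comparison_test')
  show "summable (\<lambda>m. 5 ^ r * (real (Suc m) powr (-3/2)))"
    by (subst summable_Suc_iff, intro summable_mult) (simp add: summable_real_powr_iff)
  fix m :: nat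
  have "inner_sum r m / real (m + 1) ^ 2 \<le> 5 ^ r * sqrt (real (m + 1)) / real (m + 1) ^ 2"
    by (intro divide_right_mono inner_sum_le) simp
  also have "\<dots> = 5 ^ r * (real (m + 1) powr (1/2) / real (m + 1) powr 2)"
    by (simp add: powr_half_sqrt)
  also have "\<dots> = 5 ^ r * (real (m + 1) powr (-3/2))"
    by (subst powr_diff[symmetric]) simp
  finally show "norm (inner_sum r m / real (m + 1) ^ 2) \<le> 5 ^ r * (real (Suc m) powr (-3/2))"
    using inner_sum_nonneg[of r m] by simp
qed

text \<open>The two summability claims ensure that neither infinite sum in the identity is a default
  value.\<close>

theorem mainTheorem2:
  fixes r s :: nat
  assumes "s \<ge> 1"
  shows "mzsv_term ((r + 2) # replicate (s - 1) 2) summable_on mzsv_tuples s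
    \<and> summable (\<lambda>m. (-1) ^ m / real (m + 1) ^ (2 * s) *
        (\<Sum>i=0..r. mhs m (replicate (r - i) 1) * mhs_star m (replicate i 1)))
    \<and> mzsv ((r + 2) # replicate (s - 1) 2) =
      2 * (\<Sum>m. (-1) ^ m / real (m + 1) ^ (2 * s) *
        (\<Sum>i=0..r. mhs m (replicate (r - i) 1) * mhs_star m (replicate i 1)))"
  unfolding inner_sum_def[symmetric]
proof -
  define ks where "ks = (r + 2) # replicate (s - 1) 2"
  have len: "length ks = s" using assms by (simp add: ks_def)
  define b where "b m = (-1) ^ m / real (m + 1) ^ (2 * s) * inner_sum r m" for m
  define a where "a m N = 2 * b m * binom_ratio (Suc N) (Suc m)" for m N
  have norm_b: "norm (b m) \<le> inner_sum r m / real (m + 1) ^ 2" for m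
  proof -
    \<comment> \<open>Since \<open>s\<close> is at least 1, one majorant with exponent 2 serves
      every \<open>s\<close>.\<close>
    have "real (m + 1) ^ 2 \<le> real (m + 1) ^ (2 * s)"
      using assms by (intro power_increasing) auto
    then show ?thesis
      by (auto simp: b_def abs_mult power_abs inner_sum_nonneg intro!: divide_left_mono)
  qed
  have "(\<lambda>N. binom_ratio (Suc N) (Suc m)) \<longlonglongrightarrow> 1" for m
    using binom_ratio_tendsto[of "Suc m"] by (rule LIMSEQ_Suc)
  then have lim: "a m \<longlonglongrightarrow> 2 * b m" for m
    unfolding a_def by (auto intro!: tendsto_eq_intros)
  have bound: "norm (a m N) \<le> 2 * (inner_sum r m / real (m + 1) ^ 2)" for m N
  proof -
    have "norm (a m N) = 2 * (norm (b m) * binom_ratio (Suc N) (Suc m))"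
      using binom_ratio_bounds[of "Suc N" "Suc m"] by (simp add: a_def abs_mult)
    also have "\<dots> \<le> 2 * (norm (b m) * 1)"
      using binom_ratio_bounds[of "Suc N" "Suc m"] by (intro mult_left_mono) auto
    finally show ?thesis using norm_b[of m] by simp
  qed
  have "(\<lambda>N. \<Sum>m. a m N) \<longlonglongrightarrow> (\<Sum>m. 2 * b m)"
  proof -
    have "\<forall>\<^sub>F (m, N) in at_top \<times>\<^sub>F sequentially. norm (a m N) \<le> 2 * (inner_sum r m / real (m + 1) ^ 2)"
      by (rule always_eventually) (use bound in blast)
    from tannerys_theorem[OF lim this summable_mult[OF summable_inner_sum_bound] sequentially_bot]
    show ?thesis by blast
  qed
  moreover have "(\<Sum>m. a m N) = mhs_star N ks" for N
  proof -
    \<comment> \<open>For \<open>m > N\<close> the truncation factor is zero.\<close>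
    have "(\<Sum>m. a m N) = (\<Sum>m\<le>N. a m N)"
      by (rule suminf_finite) (auto simp: a_def binom_ratio_eq_0)
    also have "\<dots> = truncated_rhs r N s"
      by (simp add: truncated_rhs_def a_def b_def mult_ac)
    finally show ?thesis
      using assms mhs_star_eq_fin_sum[of N r "s - 1"] by (simp add: ks_def)
  qed
  moreover have b: "summable b"
    using summable_inner_sum_bound[of r] norm_b by (rule summable_comparison_test'[where N = 0])
  ultimately have "(\<lambda>N. mhs_star N ks) \<longlonglongrightarrow> 2 * suminf b"
    by (simp add: suminf_mult)
  then have *: "(mzsv_term ks has_sum 2 * suminf b) (mzsv_tuples s)"
    using mzsv_term_has_sum[of ks] by (simp add: len)
  then have "mzsv ks = 2 * suminf b"
    by (simp add: mzsv_def len infsumI)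
  with * b show "mzsv_term ((r + 2) # replicate (s - 1) 2) summable_on mzsv_tuples s
    \<and> summable (\<lambda>m. (-1) ^ m / real (m + 1) ^ (2 * s) * inner_sum r m)
    \<and> mzsv ((r + 2) # replicate (s - 1) 2) =
      2 * (\<Sum>m. (-1) ^ m / real (m + 1) ^ (2 * s) * inner_sum r m)"
    by (auto simp: ks_def b_def[abs_def] has_sum_imp_summable)
qed

end
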